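(* Let $n\ge 1$. For every diagonal matrix $d\in D_n(\mathbb{C})$, the set of idempotents $q\in M_n(\mathbb{C})$ such that $E(q)=d$ is pathwise connected.
   Context: An idempotent is a matrix $q$ with $q^2=q$ (not necessarily self-adjoint). $D_n(\mathbb{C})\subset M_n(\mathbb{C})$ is the algebra of diagonal matrices, and $E\colon M_n(\mathbb{C})\to D_n(\mathbb{C})$ is the linear map that keeps the diagonal entries and replaces all off-diagonal entries by $0$. The set carries the topology inherited from $M_n(\mathbb{C})$. The set may be empty for some $d$; the empty set is regarded as pathwise connected, i.e. the claim is that any two such idempotents can be joined by a continuous path of such idempotents. *)

theory Defs
  imports "HOL-Analysis.Analysis"
begin

definition diagonal_matrices :: "(complex ^ 'n ^ 'n) set" where
  "diagonal_matrices = {A. \<forall>i j. i \<noteq> j \<longrightarrow> A $ i $ j = 0}"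

definition diagonal_expectation :: "complex ^ 'n ^ 'n \<Rightarrow> complex ^ 'n ^ 'n" where
  "diagonal_expectation A = (\<chi> i j. if i = j then A $ i $ j else 0)"

text \<open>Multiplication on the type of matrices is entrywise, so the square of a matrix
  is written with \<open>**\<close>. No self-adjointness is required.\<close>

definition idempotent_matrix :: "complex ^ 'n ^ 'n \<Rightarrow> bool" where
  "idempotent_matrix q \<longleftrightarrow> q ** q = q"

end

theory Submission
  imports Defs "HOL-Computational_Algebra.Polynomial"
begin

text \<open>The idempotents with a fixed diagonal and a fixed range form an affine space, and so do those
  with a fixed kernel. Call a range \<open>V\<close> indecomposable if no coordinate projection other
  than \<open>0\<close> and \<open>1\<close> maps \<open>V\<close> into itself. By duality, every diagonal with the right trace then
  occurs over \<open>V\<close>. An idempotent \<open>q\<close> other than \<open>0\<close> and \<open>1\<close> can be moved to one with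
  indecomposable range: if the coordinate projection \<open>P\<close> preserves its range, deform \<open>q\<close> along
  that range to commute with \<open>P\<close>, then add a nonzero \<open>X = P (1 - q) Z q (1 - P)\<close>, which keeps the
  kernel and the diagonal but destroys the invariance under \<open>P\<close> and creates no new one. Two
  idempotents \<open>p\<close> and \<open>s p s\<^sup>-\<^sup>1\<close> with indecomposable ranges are finally joined by following the
  range of \<open>p\<close> along \<open>(1 - z) + z s\<close>, where \<open>z\<close> avoids finitely many points of the plane.\<close>

subsection \<open>Fixed diagonals and fixed ranges\<close>

lemma matrix_diff_ldistrib: "A ** (B - C) = A ** B - A ** (C :: 'a::ring_1 ^ 'p ^ 'n)"
  by (simp add: vec_eq_iff matrix_matrix_mult_def sum_subtractf right_diff_distrib)

lemma matrix_diff_rdistrib: "(A - B) ** C = A ** C - B ** (C :: 'a::ring_1 ^ 'p ^ 'n)"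
  by (simp add: vec_eq_iff matrix_matrix_mult_def sum_subtractf left_diff_distrib)

lemma matrix_add_rdistrib: "(A + B) ** C = A ** C + B ** (C :: 'a::semiring_1 ^ 'p ^ 'n)"
  by (simp add: vec_eq_iff matrix_matrix_mult_def sum.distrib distrib_right)

lemmas matrix_distribs =
  matrix_add_ldistrib matrix_add_rdistrib matrix_diff_ldistrib matrix_diff_rdistrib

definition dmat :: "complex ^ 'n \<Rightarrow> complex ^ 'n ^ 'n" where
  "dmat v = (\<chi> i j. if i = j then v $ i else 0)"

lemma dmat_mult_nth: "(dmat v ** A) $ i $ j = v $ i * A $ i $ j"
  by (simp add: matrix_matrix_mult_def dmat_def if_distrib if_distribR sum.delta' cong: if_cong)

lemma mult_dmat_nth: "(A ** dmat v) $ i $ j = A $ i $ j * v $ j"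
  by (simp add: matrix_matrix_mult_def dmat_def if_distrib if_distribR sum.delta' cong: if_cong)

lemma mat_eq_dmat: "mat c = dmat (\<chi> i. c)"
  by (simp add: mat_def dmat_def vec_eq_iff)

definition idempotents_over :: "complex ^ 'n ^ 'n \<Rightarrow> (complex ^ 'n ^ 'n) set" where
  "idempotents_over d = {q. idempotent_matrix q \<and> diagonal_expectation q = d}"

lemma idempotents_over_iff:
  "q \<in> idempotents_over (diagonal_expectation p) \<longleftrightarrow> q ** q = q \<and> (\<forall>i. q $ i $ i = p $ i $ i)"
  by (auto simp: idempotents_over_def idempotent_matrix_def diagonal_expectation_def vec_eq_iff)

lemma idempotents_over_same_fibre:
  assumes "p \<in> idempotents_over d"
  shows "idempotents_over d = idempotents_over (diagonal_expectation p)"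
  using assms by (simp add: idempotents_over_def)

text \<open>For idempotents the hypothesis says \<open>(p - q)\<^sup>2 = 0\<close>, and
  \<open>x = (1 - t) p + t q\<close> satisfies
  \<open>x\<^sup>2 - x = - t (1 - t) (p - q)\<^sup>2\<close>. It covers equal ranges
  (\<open>p q = q\<close>, \<open>q p = p\<close>) and equal kernels (\<open>p q = p\<close>,
  \<open>q p = q\<close>).\<close>

lemma path_component_segment:
  assumes p: "p \<in> idempotents_over d" and q: "q \<in> idempotents_over d"
    and eq: "p ** q + q ** p = p + q"
  shows "path_component (idempotents_over d) p q"
proof -
  have pp: "p ** p = p" and qq: "q ** q = q"
    using p q by (auto simp: idempotents_over_def idempotent_matrix_def)
  have dp: "diagonal_expectation q = diagonal_expectation p"
    using p q by (auto simp: idempotents_over_def)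
  have dq: "q $ i $ i = p $ i $ i" for i
    using arg_cong[OF dp, of "\<lambda>m. m $ i $ i"] by (simp add: diagonal_expectation_def)
  have qp: "q ** p = p + q - p ** q"
    using eq by (simp add: algebra_simps)
  have "closed_segment p q \<subseteq> idempotents_over d"
  proof
    fix x assume "x \<in> closed_segment p q"
    then obtain t :: real where x: "x = (1 - t) *\<^sub>R p + t *\<^sub>R q"
      by (auto simp: in_segment)
    have "x ** x = x"
      unfolding x
      by (simp add: matrix_distribs scalar_matrix_assoc[symmetric] matrix_scalar_ac pp qq qp)
         (simp add: algebra_simps)
    moreover have "x $ i $ i = p $ i $ i" for i
      unfolding x by (simp add: dq algebra_simps)
    ultimately show "x \<in> idempotents_over d"
      unfolding idempotents_over_same_fibre[OF p] idempotents_over_iff by simp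
  qed
  then show ?thesis
    by (meson convex_closed_segment convex_imp_path_connected ends_in_segment
        path_component_of_subset path_connected_component)
qed

section \<open>Coordinate projections that preserve the range of an idempotent\<close>

definition ind :: "'n set \<Rightarrow> complex ^ 'n ^ 'n" where
  "ind S = dmat (\<chi> i. if i \<in> S then 1 else 0)"

lemma ind_idem: "ind S ** ind S = ind S"
  by (simp add: vec_eq_iff dmat_mult_nth ind_def) (simp add: dmat_def)

lemma ind_Compl: "ind (- S) = mat 1 - ind S"
  by (simp add: vec_eq_iff dmat_def ind_def mat_def)

text \<open>The sandwiched form says that the coordinate projection maps the range of the idempotent
  \<open>q\<close> into itself; the range is indecomposable iff \<open>inv_sets q \<subseteq> {{}, UNIV}\<close>.\<close>

definition inv_sets :: "complex ^ 'n ^ 'n \<Rightarrow> 'n set set" where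
  "inv_sets q = {S. q ** ind S ** q = ind S ** q}"

lemma inv_sets_Compl:
  assumes "q ** q = q" "S \<in> inv_sets q"
  shows "- S \<in> inv_sets q"
  using assms by (simp add: inv_sets_def ind_Compl matrix_distribs)

text \<open>The hypotheses say that the ranges coincide, and being preserved by a projection is a
  property of the range alone.\<close>

lemma inv_sets_same_range:
  assumes "p ** q = q" "q ** p = p"
  shows "inv_sets p = inv_sets q"
proof -
  have *: "inv_sets p \<subseteq> inv_sets q" if h: "p ** q = q" "q ** p = p" for p q :: "complex ^ 'n ^ 'n"
  proof
    fix S assume "S \<in> inv_sets p"
    then have e: "p ** ind S ** p = ind S ** p" by (simp add: inv_sets_def)
    have "q ** ind S ** q = q ** (ind S ** p) ** q"
      using h by (simp add: matrix_mul_assoc[symmetric])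
    also have "\<dots> = q ** (p ** ind S ** p) ** q" by (simp add: e)
    also have "\<dots> = (p ** ind S ** p) ** q"
      using h by (simp add: matrix_mul_assoc)
    also have "\<dots> = ind S ** q"
      using h by (simp add: e) (simp add: matrix_mul_assoc[symmetric])
    finally show "S \<in> inv_sets q" by (simp add: inv_sets_def)
  qed
  show ?thesis using *[OF assms] *[OF assms(2) assms(1)] by blast
qed

subsection \<open>Reaching an indecomposable range\<close>

text \<open>A matrix unit \<open>Z\<close> links a nonzero entry of \<open>A\<close> to one of
  \<open>B\<close>, so that their product appears as an entry of \<open>A ** Z ** B\<close>.\<close>

lemma ex_sandwich_nonzero:
  fixes A B :: "complex ^ 'n ^ 'n"
  assumes "A \<noteq> 0" "B \<noteq> 0"
  shows "\<exists>Z. A ** Z ** B \<noteq> 0"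
proof -
  obtain i j where a: "A $ i $ j \<noteq> 0" using assms(1) by (auto simp: vec_eq_iff)
  obtain k l where b: "B $ k $ l \<noteq> 0" using assms(2) by (auto simp: vec_eq_iff)
  define Z :: "complex ^ 'n ^ 'n" where "Z = (\<chi> x y. if x = j then if y = k then 1 else 0 else 0)"
  have "(A ** Z) $ i $ y = (if y = k then A $ i $ j else 0)" for y
  proof -
    have "A $ i $ x * Z $ x $ y = (if x = j then if y = k then A $ i $ j else 0 else 0)" for x
      by (simp add: Z_def)
    then show ?thesis by (simp add: matrix_matrix_mult_def)
  qed
  then have "(A ** Z) $ i $ y * B $ y $ l = (if y = k then A $ i $ j * B $ k $ l else 0)" for y
    by simp
  then have "(A ** Z ** B) $ i $ l = A $ i $ j * B $ k $ l"
    by (simp add: matrix_matrix_mult_def[of "A ** Z"])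
  then have "(A ** Z ** B) $ i $ l \<noteq> 0" using a b by simp
  then have "A ** Z ** B \<noteq> 0" by auto
  then show ?thesis ..
qed

text \<open>Deleting the two off-diagonal blocks with respect to \<open>ind S\<close> does not touch
  the diagonal. As \<open>ind S\<close> and its complement both map the range of \<open>q\<close>
  into itself, what remains is an idempotent with the same range.\<close>

lemma block_diagonalise:
  fixes q :: "complex ^ 'n ^ 'n"
  assumes q: "q \<in> idempotents_over d" and S: "S \<in> inv_sets q"
  obtains q' where "q' \<in> idempotents_over d" "q ** q' = q'" "q' ** q = q"
    "q' ** ind S = ind S ** q'"
proof -
  define P where "P = ind S"
  have PP: "P ** P = P" by (simp add: P_def ind_idem)
  have qq: "q ** q = q" using q by (auto simp: idempotents_over_def idempotent_matrix_def)
  have e: "q ** P ** q = P ** q" using S by (simp add: inv_sets_def P_def)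
  define Q where "Q = mat 1 - P"
  have QQ: "Q ** Q = Q" and PQ: "P ** Q = 0" and QP: "Q ** P = 0" and f: "q ** Q ** q = Q ** q"
    by (simp_all add: Q_def matrix_distribs PP qq e)
  \<comment> \<open>Products are normalised to left-nested form, so every relation is also needed
    behind an arbitrary left factor \<open>x\<close>.\<close>
  have R: "x ** P ** P = x ** P" "x ** q ** q = x ** q" "x ** Q ** Q = x ** Q"
      "x ** P ** Q = 0" "x ** Q ** P = 0"
      "x ** q ** P ** q = x ** P ** q" "x ** q ** Q ** q = x ** Q ** q" for x :: "complex ^ 'n ^ 'n"
    by (simp_all add: matrix_mul_assoc[symmetric] PP qq QQ PQ QP
        e[unfolded matrix_mul_assoc[symmetric]] f[unfolded matrix_mul_assoc[symmetric]])
  note R = R PP qq QQ PQ QP e f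
  define q' where "q' = P ** q ** P + Q ** q ** Q"
  have i: "q' ** q' = q'"
    unfolding q'_def by (simp add: matrix_add_ldistrib matrix_add_rdistrib matrix_mul_assoc R)
  have "q ** q' = q'"
    unfolding q'_def by (simp add: matrix_add_ldistrib matrix_mul_assoc R)
  moreover have "q' ** q = P ** q + Q ** q"
    unfolding q'_def by (simp add: matrix_add_rdistrib matrix_mul_assoc R)
  then have "q' ** q = q"
    by (simp add: Q_def matrix_diff_rdistrib)
  ultimately have r: "q ** q' = q'" "q' ** q = q" by simp_all
  have c: "q' ** P = P ** q'"
    unfolding q'_def by (simp add: matrix_add_ldistrib matrix_add_rdistrib matrix_mul_assoc R)
  have "q' $ k $ k = q $ k $ k" for k
    unfolding q'_def Q_def P_def ind_Compl[symmetric] unfolding ind_def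
    by (simp add: dmat_mult_nth mult_dmat_nth)
  with i have "q' \<in> idempotents_over d"
    unfolding idempotents_over_same_fibre[OF q] idempotents_over_iff by simp
  then show thesis using r c unfolding P_def by (rule that)
qed

text \<open>The hypotheses \<open>nz\<close> make a nonzero \<open>X = P (1 - q) Z q (1 - P)\<close>
  possible. From \<open>q X = 0\<close>, \<open>X q = X\<close> and \<open>X\<^sup>2 = 0\<close>,
  the sum \<open>q + X\<close> is an idempotent with the kernel of \<open>q\<close>; from
  \<open>P X = X\<close> and \<open>X P = 0\<close>, the diagonal of \<open>X\<close>
  vanishes.\<close>

lemma add_off_block:
  assumes q: "q \<in> idempotents_over d" and c: "q ** ind S = ind S ** q"
    and nz: "ind S ** (mat 1 - q) \<noteq> 0" "q ** (mat 1 - ind S) \<noteq> 0"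
  obtains q' where "q' \<in> idempotents_over d" "q ** q' = q" "q' ** q = q'" "q' \<noteq> q"
    "inv_sets q' \<subseteq> inv_sets q" "S \<notin> inv_sets q'"
proof -
  define P where "P = ind S"
  have PP: "P ** P = P" by (simp add: P_def ind_idem)
  have qq: "q ** q = q" using q by (auto simp: idempotents_over_def idempotent_matrix_def)
  have c: "q ** P = P ** q" using c by (simp add: P_def)
  obtain Z where Z: "(P ** (mat 1 - q)) ** Z ** (q ** (mat 1 - P)) \<noteq> 0"
    using ex_sandwich_nonzero[OF nz] unfolding P_def by (elim exE)
  define X where "X = (P ** (mat 1 - q)) ** Z ** (q ** (mat 1 - P))"
  have PX: "P ** X = X" 
    unfolding X_def by (simp add: matrix_mul_assoc PP)
  have XP: "X ** P = 0" 
    unfolding X_def by (simp add: matrix_mul_assoc[symmetric] matrix_distribs PP)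
  have qX: "q ** X = 0" 
    unfolding X_def by (simp add: matrix_mul_assoc c) 
      (simp add: matrix_mul_assoc[symmetric] matrix_distribs, simp add: matrix_mul_assoc qq)
  have Xq: "X ** q = X"
    unfolding X_def matrix_mul_assoc[symmetric]
    by (simp add: matrix_distribs) (simp add: matrix_mul_assoc c, simp add: matrix_mul_assoc[symmetric] qq)
  have XX: "X ** X = 0"
    using arg_cong[OF PX, of "(**) X"] by (simp add: matrix_mul_assoc XP)
  define q' where "q' = q + X"
  have i: "q' ** q' = q'"
    unfolding q'_def by (simp add: matrix_distribs qq qX Xq XX)
  have r: "q ** q' = q" "q' ** q = q'"
    unfolding q'_def by (simp_all add: matrix_distribs qq qX Xq)
  have "X $ k $ k = 0" for k
    using arg_cong[OF PX, of "\<lambda>m. m $ k $ k"] arg_cong[OF XP, of "\<lambda>m. m $ k $ k"]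
    by (auto simp: P_def ind_def dmat_mult_nth mult_dmat_nth split: if_splits)
  with i have m: "q' \<in> idempotents_over d"
    unfolding idempotents_over_same_fibre[OF q] idempotents_over_iff by (simp add: q'_def)
  \<comment> \<open>The invariance equation for \<open>q + X\<close> splits into blocks: the terms
    without \<open>X\<close> commute with \<open>P\<close>, while those with \<open>X\<close> are
    fixed by \<open>P\<close> on the left and killed by \<open>P\<close> on the right. The first
    group says that \<open>T\<close> is already in \<open>inv_sets q\<close>.\<close>
  have key: "(mat 1 - q) ** ind T ** q = 0 \<and> X ** ind T ** q = ind T ** X - q ** ind T ** X"
    if T: "T \<in> inv_sets q'" for T
  proof -
    define D where "D = ind T"
    have DP: "D ** P = P ** D"
      by (simp add: D_def P_def ind_def vec_eq_iff dmat_mult_nth mult_dmat_nth) (simp add: dmat_def)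
    have e: "q' ** D ** q' = D ** q'" using T by (simp add: inv_sets_def D_def)
    have XDX: "X ** D ** X = 0"
      by (metis (no_types, opaque_lifting) DP PX XP matrix_mul_assoc times0_left)
    have e1: "q ** D ** q + q ** D ** X + X ** D ** q = D ** q + D ** X"
      using e unfolding q'_def by (simp add: matrix_distribs XDX add_ac)
    have a1: "P ** (q ** D ** X) = q ** D ** X" 
      by (metis (no_types, opaque_lifting) c DP PX matrix_mul_assoc)
    have a2: "P ** (D ** X) = D ** X" 
      by (metis (no_types, opaque_lifting) DP PX matrix_mul_assoc)
    have a3: "(X ** D ** q) ** P = 0"
      by (metis (no_types, opaque_lifting) c DP XP matrix_mul_assoc times0_left)
    have a4: "(q ** D ** X) ** P = 0" "(D ** X) ** P = 0"
      by (metis XP matrix_mul_assoc times0_right)+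
    have a5: "P ** (X ** D ** q) = X ** D ** q"
      by (metis PX matrix_mul_assoc)
    have a6: "P ** (q ** D ** q) = (q ** D ** q) ** P" "P ** (D ** q) = (D ** q) ** P"
      by (metis (no_types, opaque_lifting) c DP matrix_mul_assoc)+
    have "(q ** D ** q + q ** D ** X + X ** D ** q) ** P = (D ** q + D ** X) ** P"
      using e1 by simp
    then have b1: "(q ** D ** q) ** P = (D ** q) ** P"
      by (simp add: matrix_distribs a3 a4)
    have "P ** (q ** D ** q + q ** D ** X + X ** D ** q) = P ** (D ** q + D ** X)"
      using e1 by simp
    then have b2: "q ** D ** X + X ** D ** q = D ** X"
      by (simp add: matrix_add_ldistrib a1 a2 a5 a6 b1)
    have b3: "q ** D ** q = D ** q"
      using e1 unfolding add.assoc b2 by simp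
    have "X ** D ** q = D ** X - q ** D ** X"
      unfolding b2[symmetric] by simp
    with b3 show ?thesis
      by (simp add: D_def[symmetric] matrix_diff_rdistrib)
  qed
  have sub: "inv_sets q' \<subseteq> inv_sets q"
    using key by (auto simp: inv_sets_def matrix_distribs)
  have X0: "X \<noteq> 0" using Z by (simp add: X_def)
  have "S \<notin> inv_sets q'"
  proof
    assume "S \<in> inv_sets q'"
    \<comment> \<open>For \<open>T = S\<close> the left side vanishes by \<open>X P = 0\<close> and
      the right side is \<open>X\<close>, which would force \<open>X = 0\<close>.\<close>
    from key[OF this] have "X ** P ** q = P ** X - q ** P ** X" by (simp add: P_def)
    then have "P ** X - P ** (q ** X) = 0" 
      by (simp add: XP c matrix_mul_assoc)
    then show False using X0 by (simp add: PX qX)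
  qed
  moreover have "q' \<noteq> q" using X0 by (simp add: q'_def)
  ultimately show thesis by (intro that[OF m r _ sub])
qed

lemma shrink_inv_sets:
  assumes q: "q \<in> idempotents_over d" and nz: "q \<noteq> 0" "q \<noteq> mat 1"
    and S: "S \<in> inv_sets q" "S \<noteq> {}" "S \<noteq> UNIV"
  obtains q' where "q' \<in> idempotents_over d" "path_component (idempotents_over d) q q'"
    "q' \<noteq> 0" "q' \<noteq> mat 1" "inv_sets q' \<subset> inv_sets q"
proof -
  obtain p where p: "p \<in> idempotents_over d" "q ** p = p" "p ** q = q" "p ** ind S = ind S ** p"
    using block_diagonalise[OF q S(1)] .
  have qq: "q ** q = q" using q by (auto simp: idempotents_over_def idempotent_matrix_def)
  have p0: "p \<noteq> 0" "p \<noteq> mat 1" using p nz by auto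
  have eq: "inv_sets p = inv_sets q" using inv_sets_same_range p by blast
  have qp: "path_component (idempotents_over d) q p"
    by (rule path_component_segment) (use p q in \<open>auto simp: add.commute\<close>)
  \<comment> \<open>Either \<open>S\<close> or its complement serves as \<open>T\<close>. If both
    fail, the four combinations of vanishing products give \<open>p = mat 1\<close>,
    \<open>ind S = 0\<close>, \<open>ind S = mat 1\<close> or \<open>p = 0\<close>, all
    excluded.\<close>
  have "\<exists>T \<in> inv_sets q. p ** ind T = ind T ** p \<and> ind T ** (mat 1 - p) \<noteq> 0 \<and> p ** (mat 1 - ind T) \<noteq> 0"
  proof (rule ccontr)
    assume neg: "\<not> ?thesis"
    have 1: "ind S ** (mat 1 - p) = 0 \<or> p ** (mat 1 - ind S) = 0" using neg S p by blast
    have "- S \<in> inv_sets q" using inv_sets_Compl[OF qq] S by blast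
    moreover have "p ** ind (- S) = ind (- S) ** p" by (simp add: ind_Compl matrix_distribs p)
    ultimately have "ind (- S) ** (mat 1 - p) = 0 \<or> p ** (mat 1 - ind (- S)) = 0" using neg by blast
    then have 2: "mat 1 - p - ind S ** (mat 1 - p) = 0 \<or> p ** ind S = 0"
      by (simp add: ind_Compl matrix_distribs algebra_simps)
    have 3: "ind S \<noteq> 0" using S(2) by (auto simp: ind_def dmat_def vec_eq_iff)
    have 4: "ind S \<noteq> mat 1"
    proof
      assume e: "ind S = mat 1"
      obtain i where "i \<notin> S" using S(3) by blast
      with arg_cong[OF e, of "\<lambda>m. m $ i $ i"] show False by (simp add: ind_def dmat_def mat_def)
    qed
    from 1 2 3 4 p0 p(4) show False by (auto simp: matrix_distribs)
  qed
  then obtain T where T: "T \<in> inv_sets q" "p ** ind T = ind T ** p" 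
    "ind T ** (mat 1 - p) \<noteq> 0" "p ** (mat 1 - ind T) \<noteq> 0" by blast
  obtain r where r: "r \<in> idempotents_over d" "p ** r = p" "r ** p = r" "r \<noteq> p"
    "inv_sets r \<subseteq> inv_sets p" "T \<notin> inv_sets r"
    using add_off_block[OF p(1) T(2-4)] .
  have pr: "path_component (idempotents_over d) p r"
    by (rule path_component_segment) (use p r in auto)
  have "r \<noteq> 0" "r \<noteq> mat 1" using r p0 by auto
  moreover have "inv_sets r \<subset> inv_sets q" using r T eq by auto
  ultimately show thesis
    by (rule that[OF r(1) path_component_trans[OF qp pr]])
qed

lemma reach_trivial_inv_sets:
  assumes "q \<in> idempotents_over d" "q \<noteq> 0" "q \<noteq> mat 1"
  shows "\<exists>q' \<in> idempotents_over d. path_component (idempotents_over d) q q' \<and>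
    inv_sets q' \<subseteq> {{}, UNIV}"
  using assms
proof (induction "card (inv_sets q)" arbitrary: q rule: less_induct)
  case less
  show ?case
  proof (cases "inv_sets q \<subseteq> {{}, UNIV}")
    case True
    then show ?thesis using less.prems path_component_refl by blast
  next
    case False
    then obtain S where S: "S \<in> inv_sets q" "S \<noteq> {}" "S \<noteq> UNIV" by blast
    obtain p where p: "p \<in> idempotents_over d" "path_component (idempotents_over d) q p"
      "p \<noteq> 0" "p \<noteq> mat 1" "inv_sets p \<subset> inv_sets q"
      using shrink_inv_sets[OF less.prems S] .
    have "card (inv_sets p) < card (inv_sets q)"
      using p(5) by (simp add: psubset_card_mono)
    from less.hyps[OF this p(1,3,4)] show ?thesis
      using path_component_trans[OF p(2)] by blast
  qed
qed

subsection \<open>Diagonals over an indecomposable range\<close>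

lemma mat_commute: "mat k ** A = A ** mat (k :: complex)"
  by (simp add: mat_eq_dmat vec_eq_iff dmat_mult_nth mult_dmat_nth mult.commute)

lemma mat_mult_nth: "(mat k ** A) $ i $ j = k * (A :: complex ^ 'n ^ 'n) $ i $ j"
  by (simp add: mat_eq_dmat dmat_mult_nth)

text \<open>The diagonal matrices that preserve the range of \<open>q\<close> form an algebra. It
  contains the spectral projections of \<open>dmat v\<close>, which are coordinate projections and
  hence trivial.\<close>

lemma dmat_invariant_const:
  fixes v :: "complex ^ 'n"
  assumes triv: "inv_sets q \<subseteq> {{}, UNIV}" and qq: "q ** q = q"
    and v: "q ** dmat v ** q = dmat v ** q"
  shows "v $ a = v $ b"
proof (rule ccontr)
  assume ne: "v $ a \<noteq> v $ b"
  define C where "C f \<longleftrightarrow> q ** dmat (\<chi> j. f j) ** q = dmat (\<chi> j. f j) ** q" for f :: "'n \<Rightarrow> complex"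
  have C_mult: "C (\<lambda>j. f j * g j)" if "C f" "C g" for f g
  proof -
    have e: "dmat (\<chi> j. f j * g j) = dmat (\<chi> j. f j) ** dmat (\<chi> j. g j)"
      by (simp add: vec_eq_iff dmat_mult_nth) (simp add: dmat_def)
    have "q ** (dmat (\<chi> j. f j) ** dmat (\<chi> j. g j)) ** q
        = q ** dmat (\<chi> j. f j) ** (dmat (\<chi> j. g j) ** q)"
      by (simp add: matrix_mul_assoc)
    also have "\<dots> = (q ** dmat (\<chi> j. f j) ** q) ** dmat (\<chi> j. g j) ** q"
      using that(2) unfolding C_def by (metis matrix_mul_assoc)
    also have "\<dots> = dmat (\<chi> j. f j) ** (q ** dmat (\<chi> j. g j) ** q)"
      using that(1) unfolding C_def by (simp add: matrix_mul_assoc)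
    also have "\<dots> = dmat (\<chi> j. f j) ** dmat (\<chi> j. g j) ** q"
      using that(2) unfolding C_def by (simp add: matrix_mul_assoc)
    finally show ?thesis unfolding C_def e .
  qed
  have C_lin: "C (\<lambda>j. (v $ j - c) / k)" for c k
  proof -
    have e: "dmat (\<chi> j. (v $ j - c) / k) = mat (1 / k) ** (dmat v - mat c)"
      by (simp add: vec_eq_iff mat_mult_nth) (simp add: dmat_def mat_def)
    have "q ** mat c ** q = mat c ** q"
      by (metis mat_commute matrix_mul_assoc qq)
    then have "q ** (dmat v - mat c) ** q = (dmat v - mat c) ** q"
      by (simp add: matrix_diff_ldistrib matrix_diff_rdistrib v)
    then show ?thesis unfolding C_def e
      by (metis matrix_mul_assoc mat_commute)
  qed
  have C_prod: "C (\<lambda>j. \<Prod>c\<in>F. (v $ j - c) / (v $ a - c))" if "finite F" for F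
    using that
  proof induction
    case empty
    show ?case by (simp add: C_def mat_eq_dmat[symmetric] qq)
  next
    case (insert c F)
    then show ?case using C_mult[OF C_lin insert.IH] by simp
  qed
  \<comment> \<open>The product over \<open>F\<close> is the Lagrange polynomial that is 1 at
    \<open>v $ a\<close> and 0 at the other values of \<open>v\<close>.\<close>
  define F where "F = range (\<lambda>j. v $ j) - {v $ a}"
  have "(\<Prod>c\<in>F. (v $ j - c) / (v $ a - c)) = (if v $ j = v $ a then 1 else 0)" for j
  proof (cases "v $ j = v $ a")
    case True
    then show ?thesis by (simp add: F_def)
  next
    case False
    then have "v $ j \<in> F" by (auto simp: F_def)
    then have "(\<Prod>c\<in>F. (v $ j - c) / (v $ a - c)) = 0"
      by (intro prod_zero) (auto simp: F_def)
    with False show ?thesis by simp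
  qed
  with C_prod[of F] have "{j. v $ j = v $ a} \<in> inv_sets q"
    by (simp add: F_def C_def inv_sets_def ind_def)
  then have "{j. v $ j = v $ a} \<in> {{}, UNIV}" using triv by blast
  then have "b \<in> {j. v $ j = v $ a}" by blast
  then show False using ne by simp
qed

text \<open>The trace of \<open>A\<close> times its adjoint is the squared Frobenius norm.\<close>

lemma matrix_eq_0_if_trace:
  fixes A :: "complex ^ 'n ^ 'n"
  assumes "Re (trace (A ** (\<chi> i j. cnj (A $ j $ i)))) = 0"
  shows "A = 0"
proof -
  have "(\<Sum>i\<in>UNIV. \<Sum>j\<in>UNIV. (cmod (A $ i $ j))\<^sup>2) = 0"
    using assms unfolding cmod_power2
    by (simp add: trace_def matrix_matrix_mult_def power2_eq_square)
  then have "cmod (A $ i $ j) = 0" for i j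
    by (simp add: sum_nonneg_eq_0_iff sum_nonneg)
  then show ?thesis by (simp add: vec_eq_iff)
qed

lemma inner_complex_vec:
  fixes x y :: "complex ^ 'n"
  shows "inner x y = Re (\<Sum>i\<in>UNIV. cnj (x $ i) * y $ i)"
  by (simp add: inner_vec_def inner_complex_def)

text \<open>The matrices \<open>q Y (1 - q)\<close> are the directions that keep the range of
  \<open>q\<close>. If \<open>z\<close> is orthogonal to all their diagonals, then the diagonal
  matrix of its conjugate preserves that range, so \<open>z\<close> is constant and orthogonal to
  every vector with sum 0.\<close>

lemma diagonal_of_corner:
  fixes q :: "complex ^ 'n ^ 'n" and e :: "complex ^ 'n"
  assumes triv: "inv_sets q \<subseteq> {{}, UNIV}" and qq: "q ** q = q"
    and e: "(\<Sum>i\<in>UNIV. e $ i) = 0"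
  shows "\<exists>Y. \<forall>i. (q ** Y ** (mat 1 - q)) $ i $ i = e $ i"
proof -
  define f :: "complex ^ 'n ^ 'n \<Rightarrow> complex ^ 'n"
    where "f Y = (\<chi> i. (q ** Y ** (mat 1 - q)) $ i $ i)" for Y
  have lin: "linear f"
    by (intro linearI)
       (simp_all add: f_def vec_eq_iff matrix_add_ldistrib matrix_add_rdistrib matrix_scalar_ac
         flip: scalar_matrix_assoc)
  then have sp: "span (range f) = range f"
    by (metis linear_span_image span_UNIV)
  obtain y z where y: "y \<in> span (range f)" and z: "\<And>w. w \<in> span (range f) \<Longrightarrow> orthogonal z w"
    and eyz: "e = y + z"
    using orthogonal_subspace_decomp_exists[of "range f" e] by blast
  obtain Y where Y: "y = f Y" using y sp by auto
  define l where "l = (\<chi> i. cnj (z $ i))"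
  define A where "A = (mat 1 - q) ** dmat l ** q"
  \<comment> \<open>The adjoint of \<open>A\<close> is the test matrix that turns orthogonality into
    a vanishing Frobenius norm of \<open>A\<close>.\<close>
  define B :: "complex ^ 'n ^ 'n" where "B = (\<chi> i j. cnj (A $ j $ i))"
  have "inner z (f B) = 0"
    using z[of "f B"] sp by (simp add: orthogonal_def)
  also have "inner z (f B) = Re (trace (dmat l ** (q ** B ** (mat 1 - q))))"
    by (simp add: inner_complex_vec f_def trace_def dmat_mult_nth l_def)
  also have "dmat l ** (q ** B ** (mat 1 - q)) = (dmat l ** q ** B) ** (mat 1 - q)"
    by (simp add: matrix_mul_assoc)
  also have "trace \<dots> = trace (A ** B)"
    unfolding A_def by (subst trace_mul_sym) (simp add: matrix_mul_assoc)
  finally have "A = 0"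
    unfolding B_def by (rule matrix_eq_0_if_trace)
  then have "q ** dmat l ** q = dmat l ** q"
    by (simp add: A_def matrix_diff_rdistrib)
  then have const: "l $ i = l $ j" for i j
    using dmat_invariant_const[OF triv qq] by blast
  have "inner z e = Re (\<Sum>i\<in>UNIV. l $ i * e $ i)"
    by (simp add: inner_complex_vec l_def)
  also have "(\<Sum>i\<in>UNIV. l $ i * e $ i) = (\<Sum>i\<in>UNIV. l $ undefined * e $ i)"
    by (intro sum.cong refl) (metis const)
  also have "\<dots> = 0" using e by (simp flip: sum_distrib_left)
  finally have "inner z e = 0" by simp
  moreover have "inner z y = 0" using z[OF y] by (simp add: orthogonal_def)
  ultimately have "z = 0" by (simp add: eyz inner_add_right)
  then show ?thesis
    using eyz Y by (auto simp: f_def vec_eq_iff)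
qed

subsection \<open>Moving the range along a line of matrices\<close>

definition polyfun :: "(complex \<Rightarrow> complex) \<Rightarrow> bool" where
  "polyfun f \<longleftrightarrow> (\<exists>p. f = poly p)"

lemma polyfun_const: "polyfun (\<lambda>z. c)"
  unfolding polyfun_def by (rule exI[of _ "[:c:]"]) auto

lemma polyfun_id: "polyfun (\<lambda>z. z)"
  unfolding polyfun_def by (rule exI[of _ "[:0, 1:]"]) auto

lemma polyfun_add: "polyfun f \<Longrightarrow> polyfun g \<Longrightarrow> polyfun (\<lambda>z. f z + g z)"
  unfolding polyfun_def fun_eq_iff by (metis poly_add)

lemma polyfun_diff: "polyfun f \<Longrightarrow> polyfun g \<Longrightarrow> polyfun (\<lambda>z. f z - g z)"
  unfolding polyfun_def fun_eq_iff by (metis poly_diff)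

lemma polyfun_mult: "polyfun f \<Longrightarrow> polyfun g \<Longrightarrow> polyfun (\<lambda>z. f z * g z)"
  unfolding polyfun_def fun_eq_iff by (metis poly_mult)

lemma polyfun_sum: "(\<And>i. i \<in> I \<Longrightarrow> polyfun (f i)) \<Longrightarrow> polyfun (\<lambda>z. \<Sum>i\<in>I. f i z)"
  by (induction I rule: infinite_finite_induct) (auto intro: polyfun_const polyfun_add)

lemma polyfun_prod: "(\<And>i. i \<in> I \<Longrightarrow> polyfun (f i)) \<Longrightarrow> polyfun (\<lambda>z. \<Prod>i\<in>I. f i z)"
  by (induction I rule: infinite_finite_induct) (auto intro: polyfun_const polyfun_mult)

lemma polyfun_det:
  assumes "\<And>i j. polyfun (\<lambda>z. A z $ i $ j)"
  shows "polyfun (\<lambda>z. det (A z))"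
  unfolding det_def by (intro polyfun_sum polyfun_mult polyfun_const polyfun_prod assms)

lemma polyfun_matrix_mult:
  assumes "\<And>i j. polyfun (\<lambda>z. A z $ i $ j)" "\<And>i j. polyfun (\<lambda>z. B z $ i $ j)"
  shows "polyfun (\<lambda>z. (A z ** B z) $ i $ j)"
  by (simp add: matrix_matrix_mult_def) (intro polyfun_sum polyfun_mult assms)

lemma continuous_on_polyfun: "polyfun f \<Longrightarrow> continuous_on S f"
  unfolding polyfun_def by (auto intro: continuous_intros)

section \<open>Adjugates, as polynomial substitutes for inverses\<close>

text \<open>Column \<open>j\<close> collects the numerators in Cramer's rule for the
  \<open>j\<close>-th unit vector, so the entries are polynomial in those of \<open>A\<close> even
  where \<open>A\<close> is singular.\<close>

definition adjugate :: "complex ^ 'n ^ 'n \<Rightarrow> complex ^ 'n ^ 'n" where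
  "adjugate A = (\<chi> k j. det (\<chi> i l. if l = k then mat 1 $ i $ j else A $ i $ l))"

lemma adjugate_right:
  fixes A :: "complex ^ 'n ^ 'n"
  assumes "det A \<noteq> 0"
  shows "A ** adjugate A = mat (det A)"
proof -
  have "(A ** adjugate A) $ i $ j = mat (det A) $ i $ j" for i j
  proof -
    define b :: "complex ^ 'n" where "b = (\<chi> i. mat 1 $ i $ j)"
    define x where "x = (\<chi> k. det (\<chi> i l. if l = k then b $ i else A $ i $ l) / det A)"
    have "A *v x = b" using cramer[OF assms, of x b] by (simp add: x_def)
    then have "(\<Sum>k\<in>UNIV. A $ i $ k * x $ k) = b $ i"
      by (simp add: matrix_vector_mult_def vec_eq_iff)
    moreover have "adjugate A $ k $ j = det A * x $ k" for k
      using assms by (simp add: adjugate_def x_def b_def cong: if_cong)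
    then have "(A ** adjugate A) $ i $ j = det A * (\<Sum>k\<in>UNIV. A $ i $ k * x $ k)"
      by (simp add: matrix_matrix_mult_def sum_distrib_left algebra_simps)
    ultimately show ?thesis by (simp add: b_def mat_def)
  qed
  then show ?thesis by (simp add: vec_eq_iff)
qed

lemma adjugate_inverse:
  assumes "det A \<noteq> 0"
  shows "A ** (mat (1 / det A) ** adjugate A) = mat 1" "mat (1 / det A) ** adjugate A ** A = mat 1"
proof -
  have "A ** (mat (1 / det A) ** adjugate A) = mat (1 / det A) ** (A ** adjugate A)"
    by (metis mat_commute matrix_mul_assoc)
  also have "\<dots> = mat 1"
    using assms by (simp add: adjugate_right vec_eq_iff mat_mult_nth) (simp add: mat_def)
  finally show 1: "A ** (mat (1 / det A) ** adjugate A) = mat 1" .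
  then show "mat (1 / det A) ** adjugate A ** A = mat 1"
    using matrix_left_right_inverse by blast
qed

text \<open>The adjugate is \<open>det A\<close> times the inverse, and the trace is invariant under
  conjugation.\<close>

lemma trace_conjugate_adjugate:
  assumes "det A \<noteq> 0"
  shows "trace (A ** K ** adjugate A) = det A * trace K"
proof -
  have "adjugate A ** A = mat (det A)"
  proof -
    have "mat (det A) ** (mat (1 / det A) ** adjugate A ** A) = adjugate A ** A"
      using assms by (simp add: vec_eq_iff mat_mult_nth flip: matrix_mul_assoc)
    then show ?thesis by (simp add: adjugate_inverse[OF assms])
  qed
  moreover have "trace (A ** K ** adjugate A) = trace (adjugate A ** A ** K)"
    by (subst trace_mul_sym) (simp add: matrix_mul_assoc)
  ultimately show ?thesis
    by (simp add: trace_def mat_mult_nth sum_distrib_left)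
qed

lemma polyfun_adjugate:
  assumes "\<And>i j. polyfun (\<lambda>z. A z $ i $ j)"
  shows "polyfun (\<lambda>z. adjugate (A z) $ i $ j)"
  unfolding adjugate_def vec_lambda_beta
proof (rule polyfun_det)
  show "polyfun (\<lambda>z. (\<chi> k l. if l = i then mat 1 $ k $ j else A z $ k $ l) $ k $ l)" for k l
    by (cases "l = i") (simp_all add: assms polyfun_const)
qed

lemma matrix_sandwich_sum_nth:
  fixes X Y :: "complex ^ 'n ^ 'n"
  assumes "finite I"
  shows "(X ** (\<Sum>k\<in>I. mat (c k) ** K k) ** Y) $ i $ j = (\<Sum>k\<in>I. c k * (X ** K k ** Y) $ i $ j)"
  using assms
proof induction
  case empty
  show ?case by simp
next
  case (insert k I)
  have "X ** (mat (c k) ** K k) ** Y = mat (c k) ** (X ** K k ** Y)"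
    by (metis mat_commute matrix_mul_assoc)
  with insert show ?case
    by (simp add: matrix_add_ldistrib matrix_add_rdistrib mat_mult_nth)
qed

text \<open>The idempotents with range \<open>s(z) V\<close>, where \<open>V\<close> is the range of \<open>q\<close>, are
  \<open>s(z) (q + K) s(z)\<^sup>-\<^sup>1\<close> with \<open>q K = K\<close>, \<open>K q = 0\<close>. If \<open>V\<close> is indecomposable, the
  diagonal condition is a square linear system in the coordinates of \<open>K\<close> whose determinant is a
  polynomial in \<open>z\<close> not vanishing at \<open>z = 0\<close>; Cramer's rule solves it continuously off
  finitely many points of the plane.\<close>

lemma path_to_translated_range:
  fixes q s :: "complex ^ 'n ^ 'n"
  assumes q: "q \<in> idempotents_over d" and triv: "inv_sets q \<subseteq> {{}, UNIV}"
  defines "\<sigma> \<equiv> \<lambda>z. mat (1 - z) + mat z ** s"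
  shows "\<exists>F. finite F \<and> (\<forall>z. z \<notin> F \<longrightarrow> (\<exists>p t. path_component (idempotents_over d) q p \<and>
    \<sigma> z ** t = mat 1 \<and> p ** (\<sigma> z ** q ** t) = \<sigma> z ** q ** t \<and> (\<sigma> z ** q ** t) ** p = p))"
proof -
  have qq: "q ** q = q" using q by (auto simp: idempotents_over_def idempotent_matrix_def)
  define n where "n = (of_nat CARD('n) :: complex)"
  have n0: "n \<noteq> 0" by (simp add: n_def)
  \<comment> \<open>The prescribed diagonal is the \<open>j\<close>-th unit vector made traceless,
    as a matrix with \<open>q K = K\<close> and \<open>K q = 0\<close> has trace 0.\<close>
  have "\<exists>K. q ** K = K \<and> K ** q = 0 \<and> (\<forall>i. K $ i $ i = (if i = j then 1 else 0) - 1 / n)" for j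
  proof -
    have "(\<Sum>i\<in>UNIV. (\<chi> i. (if i = j then 1 else 0) - 1 / n) $ i) = 0"
      using n0 by (simp add: sum_subtractf n_def)
    from diagonal_of_corner[OF triv qq this] obtain Y
      where Y: "\<forall>i. (q ** Y ** (mat 1 - q)) $ i $ i = (if i = j then 1 else 0) - 1 / n" by auto
    have "q ** (q ** Y ** (mat 1 - q)) = q ** Y ** (mat 1 - q)"
      by (simp add: matrix_mul_assoc qq)
    moreover have "q ** Y ** (mat 1 - q) ** q = 0"
      by (simp add: matrix_mul_assoc[symmetric] matrix_diff_rdistrib qq)
    ultimately show ?thesis using Y by blast
  qed
  then obtain K where K1: "\<And>j. q ** K j = K j" and K2: "\<And>j. K j ** q = 0"
    and K3: "\<And>j i. K j $ i $ i = (if i = j then 1 else 0) - 1 / n" by metis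
  have trK: "trace (K j) = 0" for j
    using n0 by (simp add: trace_def K3 sum_subtractf n_def)
  \<comment> \<open>With the adjugate in place of the inverse, the linear system is scaled by
    \<open>D z\<close> and has polynomial coefficients.\<close>
  define A where "A z = adjugate (\<sigma> z)" for z
  define D where "D z = det (\<sigma> z)" for z
  \<comment> \<open>Without the summand \<open>D z * (1 / n)\<close> the system would be singular:
    at \<open>z = 0\<close> it would be the identity minus \<open>1 / n\<close> in every entry. With
    it, \<open>N 0 = mat 1\<close>.\<close>
  define N :: "complex \<Rightarrow> complex ^ 'n ^ 'n"
    where "N z = (\<chi> i j. (\<sigma> z ** K j ** A z) $ i $ i + D z * (1 / n))" for z
  define b where "b z = (\<chi> i. D z * q $ i $ i - (\<sigma> z ** q ** A z) $ i $ i)" for z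
  define h where "h z k = det (\<chi> i j. if j = k then b z $ i else N z $ i $ j)" for z k
  define c where "c z k = h z k / det (N z)" for z k
  define E where "E z = q + (\<Sum>k\<in>UNIV. mat (c z k) ** K k)" for z
  define T where "T z = mat (1 / D z) ** A z" for z
  define P where "P z = \<sigma> z ** E z ** T z" for z

  have pol\<sigma>: "polyfun (\<lambda>z. \<sigma> z $ i $ j)" for i j
    unfolding \<sigma>_def
    by (cases "i = j") (auto simp: mat_mult_nth mat_def[of "1 - _"]
          intro!: polyfun_const polyfun_id polyfun_add polyfun_mult polyfun_diff)
  have polA: "polyfun (\<lambda>z. A z $ i $ j)" for i j
    unfolding A_def by (intro polyfun_adjugate pol\<sigma>)
  have polD: "polyfun D"
    unfolding D_def by (intro polyfun_det pol\<sigma>)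
  have polX: "polyfun (\<lambda>z. (\<sigma> z ** X ** A z) $ i $ j)" for X i j
    by (intro polyfun_matrix_mult pol\<sigma> polA polyfun_const)
  have polN: "polyfun (\<lambda>z. N z $ i $ j)" for i j
    unfolding N_def vec_lambda_beta by (intro polyfun_add polyfun_mult polD polX polyfun_const)
  have polb: "polyfun (\<lambda>z. b z $ i)" for i
    unfolding b_def vec_lambda_beta by (intro polyfun_diff polyfun_mult polD polX polyfun_const)
  have polh: "polyfun (\<lambda>z. h z k)" for k
    unfolding h_def
  proof (rule polyfun_det)
    show "polyfun (\<lambda>z. (\<chi> i j. if j = k then b z $ i else N z $ i $ j) $ i $ j)" for i j
      by (cases "j = k") (simp_all add: polN polb)
  qed
  have polg: "polyfun (\<lambda>z. D z * det (N z))"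
    by (intro polyfun_mult polD polyfun_det polN)

  have \<sigma>0: "\<sigma> 0 = mat 1" by (simp add: \<sigma>_def)
  have D0: "D 0 = 1" by (simp add: D_def \<sigma>0 det_I)
  have A0: "A 0 = mat 1"
    using adjugate_right[of "mat 1 :: complex ^ 'n ^ 'n"] by (simp add: A_def \<sigma>0 det_I)
  have N0: "N 0 = mat 1"
    by (simp add: N_def \<sigma>0 A0 D0 vec_eq_iff K3) (simp add: mat_def)
  have b0: "b 0 = 0"
    by (simp add: b_def \<sigma>0 A0 D0 vec_eq_iff)

  obtain g where g: "(\<lambda>z. D z * det (N z)) = poly g" using polg by (auto simp: polyfun_def)
  have "poly g 0 = 1" by (simp add: g[symmetric] D0 N0 det_I)
  then have "g \<noteq> 0" by auto
  define F where "F = {z. D z * det (N z) = 0}"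
  have finF: "finite F"
    using poly_roots_finite[OF \<open>g \<noteq> 0\<close>] by (simp add: F_def fun_cong[OF g])
  have F0: "0 \<notin> F" by (simp add: F_def D0 N0 det_I)

  have P_nth: "P z $ i $ j = 1 / D z * ((\<sigma> z ** q ** A z) $ i $ j
      + (\<Sum>k\<in>UNIV. c z k * (\<sigma> z ** K k ** A z) $ i $ j))" for z i j
  proof -
    have "P z = mat (1 / D z) ** (\<sigma> z ** E z ** A z)"
      unfolding P_def T_def by (metis mat_commute matrix_mul_assoc)
    also have "\<sigma> z ** E z ** A z = \<sigma> z ** q ** A z +
        \<sigma> z ** (\<Sum>k\<in>UNIV. mat (c z k) ** K k) ** A z"
      by (simp add: E_def matrix_add_ldistrib matrix_add_rdistrib)
    finally show ?thesis
      by (simp add: mat_mult_nth matrix_sandwich_sum_nth)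
  qed
  have Nc: "N z *v (\<chi> k. c z k) = b z" if "z \<notin> F" for z
    using that cramer[of "N z" "\<chi> k. c z k" "b z"] by (simp add: F_def c_def h_def)
  have P0: "P 0 = q"
  proof -
    have "(\<chi> k. c 0 k) = 0" using Nc[OF F0] by (simp add: N0 b0)
    then have "c 0 k = 0" for k by (simp add: vec_eq_iff)
    then show ?thesis by (simp add: P_def E_def T_def \<sigma>0 A0 D0)
  qed
  have cont: "continuous_on (- F) P"
  proof -
    have "continuous_on (- F) (\<lambda>z. \<chi> i j. P z $ i $ j)"
      unfolding P_nth c_def
      by (intro continuous_on_vec_lambda continuous_intros
            continuous_on_polyfun[OF polD] continuous_on_polyfun[OF polX] continuous_on_polyfun[OF polh]
            continuous_on_polyfun[OF polyfun_det[OF polN]]) (auto simp: F_def)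
    then show ?thesis by simp
  qed
  have T: "\<sigma> z ** T z = mat 1" "T z ** \<sigma> z = mat 1" if "z \<notin> F" for z
    using that adjugate_inverse[of "\<sigma> z"] by (simp_all add: F_def T_def D_def A_def)
  have qE: "q ** E z = E z" and Eq: "E z ** q = q" for z
  proof -
    have "q ** (\<Sum>k\<in>I. mat (c z k) ** K k) = (\<Sum>k\<in>I. mat (c z k) ** K k) \<and>
      (\<Sum>k\<in>I. mat (c z k) ** K k) ** q = 0" if "finite I" for I
      using that
    proof induction
      case (insert k I)
      have "q ** (mat (c z k) ** K k) = mat (c z k) ** K k"
        by (metis mat_commute matrix_mul_assoc K1)
      moreover have "mat (c z k) ** K k ** q = 0"
        by (simp add: matrix_mul_assoc[symmetric] K2)
      ultimately show ?case using insert
        by (simp add: matrix_add_ldistrib matrix_add_rdistrib)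
    qed simp
    then show "q ** E z = E z" "E z ** q = q"
      by (simp_all add: E_def matrix_add_ldistrib matrix_add_rdistrib qq)
  qed
  have EE: "E z ** E z = E z" for z
    by (metis qE Eq matrix_mul_assoc)
  have conj: "(\<sigma> z ** X ** T z) ** (\<sigma> z ** Y ** T z) = \<sigma> z ** (X ** Y) ** T z" if "z \<notin> F" for X Y z
  proof -
    have "(\<sigma> z ** X ** T z) ** (\<sigma> z ** Y ** T z) = \<sigma> z ** X ** (T z ** \<sigma> z) ** Y ** T z"
      by (simp add: matrix_mul_assoc)
    then show ?thesis by (simp add: T[OF that] matrix_mul_assoc)
  qed
  have P_in: "P z \<in> idempotents_over d" if z: "z \<notin> F" for z
  proof -
    have D: "D z \<noteq> 0" using z by (simp add: F_def)
    have tr: "trace (\<sigma> z ** X ** A z) = D z * trace X" for X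
      using D trace_conjugate_adjugate[of "\<sigma> z" X] by (simp add: D_def A_def)
    have row: "(\<Sum>k\<in>UNIV. (\<sigma> z ** K k ** A z) $ i $ i * c z k) + D z * (1 / n) * (\<Sum>k\<in>UNIV. c z k)
        = D z * q $ i $ i - (\<sigma> z ** q ** A z) $ i $ i" for i
    proof -
      have "(N z *v (\<chi> k. c z k)) $ i = b z $ i" using Nc[OF z] by simp
      then show ?thesis
        by (simp add: matrix_vector_mult_def N_def b_def distrib_right sum.distrib sum_distrib_left)
    qed
    \<comment> \<open>Summing all rows compares traces: the \<open>K k\<close> are traceless and
      conjugation keeps the trace of \<open>q\<close>, so the coefficients sum to 0. The extra
      summand in \<open>N z\<close> thus contributes nothing, and each row is the desired diagonal
      condition.\<close>
    have "(\<Sum>i\<in>UNIV. (\<Sum>k\<in>UNIV. (\<sigma> z ** K k ** A z) $ i $ i * c z k) + D z * (1 / n) * (\<Sum>k\<in>UNIV. c z k))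
        = D z * trace q - trace (\<sigma> z ** q ** A z)"
      unfolding row by (simp add: trace_def sum_subtractf sum_distrib_left)
    also have "\<dots> = 0" by (simp add: tr)
    also have "(\<Sum>i\<in>UNIV. (\<Sum>k\<in>UNIV. (\<sigma> z ** K k ** A z) $ i $ i * c z k) + D z * (1 / n) * (\<Sum>k\<in>UNIV. c z k))
        = (\<Sum>i\<in>UNIV. \<Sum>k\<in>UNIV. (\<sigma> z ** K k ** A z) $ i $ i * c z k) + D z * (\<Sum>k\<in>UNIV. c z k)"
      using n0 by (simp add: sum.distrib n_def)
    also have "(\<Sum>i\<in>UNIV. \<Sum>k\<in>UNIV. (\<sigma> z ** K k ** A z) $ i $ i * c z k)
        = (\<Sum>k\<in>UNIV. trace (\<sigma> z ** K k ** A z) * c z k)"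
      by (subst sum.swap) (simp add: trace_def sum_distrib_right)
    also have "\<dots> = 0" by (simp add: tr trK)
    finally have c0: "(\<Sum>k\<in>UNIV. c z k) = 0" using D by simp
    have "P z $ i $ i = q $ i $ i" for i
      using row[of i] D by (simp add: P_nth c0 mult.commute field_simps)
    moreover have "P z ** P z = P z"
      by (simp add: P_def conj[OF z] EE)
    ultimately show ?thesis
      unfolding idempotents_over_same_fibre[OF q] idempotents_over_iff by simp
  qed
  \<comment> \<open>Here the parameter has to range over the plane: removing a point would
    disconnect the real line.\<close>
  have "path_connected (- F)"
    by (intro path_connected_complement_countable countable_finite finF) simp
  then have "path_connected (P ` (- F))"
    by (rule path_connected_continuous_image[OF cont])
  then have "path_component (P ` (- F)) q (P z)" if "z \<notin> F" for z
    using that F0 P0 unfolding path_connected_component by (metis ComplI imageI)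
  then have comp: "path_component (idempotents_over d) q (P z)" if "z \<notin> F" for z
    using that P_in by (meson ComplD image_subsetI path_component_of_subset)
  show ?thesis
  proof (intro exI[of _ F] conjI finF allI impI)
    fix z assume z: "z \<notin> F"
    show "\<exists>p t. path_component (idempotents_over d) q p \<and>
      \<sigma> z ** t = mat 1 \<and> p ** (\<sigma> z ** q ** t) = \<sigma> z ** q ** t \<and> (\<sigma> z ** q ** t) ** p = p"
      by (rule exI[of _ "P z"], rule exI[of _ "T z"])
         (use comp[OF z] in \<open>simp add: z T conj P_def qE Eq\<close>)
  qed
qed

subsection \<open>Similarity of idempotents with the same trace\<close>

text \<open>Since \<open>x = q x + (x - q x)\<close>, the eigenvectors for 1 and 0 span the space. A
  basis of them gives the columns of \<open>s\<close>, and \<open>S\<close> marks those fixed by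
  \<open>q\<close>.\<close>

lemma idempotent_similar_ind:
  fixes q :: "complex ^ 'n ^ 'n"
  assumes qq: "q ** q = q"
  obtains s t :: "complex ^ 'n ^ 'n" and S where "s ** t = mat 1" "t ** s = mat 1" "q = s ** ind S ** t"
proof -
  define V where "V = {v. q *v v = v} \<union> {v. q *v v = 0}"
  obtain B where B: "B \<subseteq> V" "vec.independent B" "V \<subseteq> vec.span B"
    using vec.maximal_independent_subset .
  have "x \<in> vec.span B" for x
  proof -
    have "q *v x \<in> V" "x - q *v x \<in> V"
      by (auto simp: V_def matrix_vector_mul_assoc qq matrix_vector_mult_diff_distrib)
    then have "q *v x + (x - q *v x) \<in> vec.span B"
      using B(3) by (intro vec.span_add) auto
    then show ?thesis by simp
  qed
  then have span: "vec.span B = UNIV" by auto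
  have "card B = CARD('n)"
    using vec.dim_eq_card[OF _ B(2), of UNIV] span vec_dim_card[where 'a = complex and 'n = 'n]
    by (simp only: vec.span_UNIV)
  moreover have "finite B" using B(2) by (rule vec.finiteI_independent)
  ultimately obtain f where f: "bij_betw f (UNIV :: 'n set) B"
    by (metis finite_same_card_bij finite)
  define s :: "complex ^ 'n ^ 'n" where "s = (\<chi> i j. f j $ i)"
  have "columns s = B"
    using f by (auto simp: columns_def column_def s_def bij_betw_def)
  then obtain t where t: "s ** t = mat 1"
    using matrix_right_invertible_span_columns[of s] span by auto
  then have t': "t ** s = mat 1" by (simp add: matrix_left_right_inverse)
  define S where "S = {j. q *v f j = f j}"
  have "q ** s = s ** ind S"
  proof -
    have "(q ** s) $ i $ j = (s ** ind S) $ i $ j" for i j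
    proof -
      have "f j \<in> V" using f B(1) by (auto simp: bij_betw_def)
      then have "q *v f j = (if j \<in> S then f j else 0)" by (auto simp: V_def S_def)
      moreover have "(q ** s) $ i $ j = (q *v f j) $ i"
        by (simp add: matrix_matrix_mult_def matrix_vector_mult_def s_def)
      ultimately show ?thesis by (simp add: ind_def mult_dmat_nth s_def)
    qed
    then show ?thesis by (simp add: vec_eq_iff)
  qed
  then have "q = s ** ind S ** t"
    using t by (metis matrix_mul_assoc matrix_mul_rid)
  with t t' show thesis by (rule that)
qed

lemma trace_ind: "trace (ind S) = of_nat (card S)"
  by (simp add: trace_def ind_def dmat_def sum.If_cases)

lemma trace_similar:
  fixes s t a :: "complex ^ 'n ^ 'n"
  assumes "t ** s = mat 1"
  shows "trace (s ** a ** t) = trace a"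
  by (subst trace_mul_sym) (simp add: matrix_mul_assoc assms)

text \<open>A bijection from \<open>S\<close> to \<open>S'\<close>, extended by one between the
  complements, gives a permutation matrix.\<close>

lemma ind_similar:
  fixes S S' :: "'n::finite set"
  assumes "card S = card S'"
  obtains u v :: "complex ^ 'n ^ 'n" where "u ** v = mat 1" "v ** u = mat 1" "ind S' = u ** ind S ** v"
proof -
  have "card (- S) = card (- S')" using assms by (simp add: Compl_eq_Diff_UNIV card_Diff_subset)
  then obtain f g where "bij_betw f S S'" "bij_betw g (- S) (- S')"
    using assms by (meson finite finite_same_card_bij)
  then have "bij_betw (\<lambda>x. if x \<in> S then f x else g x) (S \<union> - S) (S' \<union> - S')"
    by (intro bij_betw_disjoint_Un) auto
  then obtain h :: "'n \<Rightarrow> 'n" where h: "bij h" "\<And>x. h x \<in> S' \<longleftrightarrow> x \<in> S"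
    using \<open>bij_betw f S S'\<close> \<open>bij_betw g (- S) (- S')\<close>
    by (intro that[of "\<lambda>x. if x \<in> S then f x else g x"]) (auto simp: bij_betw_def)
  define u :: "complex ^ 'n ^ 'n" where "u = (\<chi> i j. if i = h j then 1 else 0)"
  define v :: "complex ^ 'n ^ 'n" where "v = (\<chi> i j. if h i = j then 1 else 0)"
  have "(v ** u) $ i $ j = mat 1 $ i $ j" for i j
  proof -
    have "v $ i $ k * u $ k $ j = (if k = h i then if h i = h j then 1 else 0 else 0)" for k
      by (simp add: u_def v_def)
    then show ?thesis
      using h(1) by (simp add: matrix_matrix_mult_def mat_def bij_def inj_eq)
  qed
  then have vu: "v ** u = mat 1" by (simp add: vec_eq_iff)
  then have uv: "u ** v = mat 1" by (simp add: matrix_left_right_inverse)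
  have "u ** ind S = ind S' ** u"
    by (auto simp: vec_eq_iff ind_def dmat_mult_nth mult_dmat_nth u_def h(2))
  then have "ind S' = u ** ind S ** v"
    using uv by (metis matrix_mul_assoc matrix_mul_rid)
  with uv vu show thesis by (rule that)
qed

lemma idempotents_same_trace_similar:
  fixes p q :: "complex ^ 'n ^ 'n"
  assumes "p ** p = p" "q ** q = q" "trace p = trace q"
  obtains s t where "s ** t = mat 1" "t ** s = mat 1" "q = s ** p ** t"
proof -
  obtain s t :: "complex ^ 'n ^ 'n" and S where p: "s ** t = mat 1" "t ** s = mat 1" "p = s ** ind S ** t"
    using idempotent_similar_ind[OF assms(1)] .
  obtain s' t' :: "complex ^ 'n ^ 'n" and S' where q: "s' ** t' = mat 1" "t' ** s' = mat 1" "q = s' ** ind S' ** t'"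
    using idempotent_similar_ind[OF assms(2)] .
  have "card S = card S'"
    using assms(3) unfolding p(3) q(3) by (simp add: trace_similar p(2) q(2) trace_ind)
  then obtain u v where u: "u ** v = mat 1" "v ** u = mat 1" "ind S' = u ** ind S ** v"
    by (rule ind_similar)
  have canc: "x ** s ** t = x" "x ** t ** s = x" "x ** s' ** t' = x" "x ** t' ** s' = x"
    "x ** u ** v = x" "x ** v ** u = x" for x :: "complex ^ 'n ^ 'n"
    by (simp_all add: matrix_mul_assoc[symmetric] p(1,2) q(1,2) u(1,2))
  show thesis
    by (rule that[of "s' ** u ** t" "s ** v ** t'"])
       (simp_all add: p(3) q(3) u(3) matrix_mul_assoc canc p(1,2) q(1,2) u(1,2))
qed

section \<open>Joining idempotents with indecomposable ranges\<close>

text \<open>The endpoint \<open>z = 1\<close> may be an excluded parameter, so the two ends meet in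
  between: \<open>p\<close> moves along \<open>(1 - z) + z s\<close> and \<open>q\<close> along
  \<open>z + (1 - z) t\<close>. Multiplying the latter by \<open>s\<close> gives the former, so both
  arrive over the same range and a segment finishes.\<close>

lemma path_component_trivial_inv_sets:
  fixes p q :: "complex ^ 'n ^ 'n"
  assumes p: "p \<in> idempotents_over d" "inv_sets p \<subseteq> {{}, UNIV}"
    and q: "q \<in> idempotents_over d" "inv_sets q \<subseteq> {{}, UNIV}"
    and s: "s ** t = mat 1" "t ** s = mat 1" "q = s ** p ** t"
  shows "path_component (idempotents_over d) p q"
proof -
  obtain F where F: "finite F" and F': "\<And>z. z \<notin> F \<Longrightarrow>
      \<exists>x y. path_component (idempotents_over d) p x \<and> (mat (1 - z) + mat z ** s) ** y = mat 1 \<and>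
      x ** ((mat (1 - z) + mat z ** s) ** p ** y) = (mat (1 - z) + mat z ** s) ** p ** y \<and>
      ((mat (1 - z) + mat z ** s) ** p ** y) ** x = x"
    using path_to_translated_range[OF p, of s] by blast
  obtain G where G: "finite G" and G': "\<And>z. z \<notin> G \<Longrightarrow>
      \<exists>x y. path_component (idempotents_over d) q x \<and> (mat (1 - z) + mat z ** t) ** y = mat 1 \<and>
      x ** ((mat (1 - z) + mat z ** t) ** q ** y) = (mat (1 - z) + mat z ** t) ** q ** y \<and>
      ((mat (1 - z) + mat z ** t) ** q ** y) ** x = x"
    using path_to_translated_range[OF q, of t] by blast
  have "finite (F \<union> (\<lambda>z. 1 - z) ` G)" using F G by simp
  then obtain z where "z \<notin> F \<union> (\<lambda>z. 1 - z) ` G"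
    using ex_new_if_finite[OF infinite_UNIV_char_0] by blast
  then have zF: "z \<notin> F" and zG: "1 - z \<notin> G" by (auto simp: image_iff)
  define \<sigma> where "\<sigma> = mat (1 - z) + mat z ** s"
  define \<tau> where "\<tau> = mat z + mat (1 - z) ** t"
  obtain x y where x: "path_component (idempotents_over d) p x" "\<sigma> ** y = mat 1"
    "x ** (\<sigma> ** p ** y) = \<sigma> ** p ** y" "(\<sigma> ** p ** y) ** x = x"
    using F'[OF zF] unfolding \<sigma>_def[symmetric] by blast
  obtain x' y' where x': "path_component (idempotents_over d) q x'" "\<tau> ** y' = mat 1"
    "x' ** (\<tau> ** q ** y') = \<tau> ** q ** y'" "(\<tau> ** q ** y') ** x' = x'"
    using G'[OF zG] unfolding \<tau>_def by auto
  have \<tau>s: "\<tau> ** s = \<sigma>"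
    by (simp add: \<tau>_def \<sigma>_def matrix_add_rdistrib matrix_mul_assoc[symmetric] s)
  have "\<sigma> ** (t ** y') = \<tau> ** (s ** t) ** y'"
    by (simp add: \<tau>s[symmetric] matrix_mul_assoc)
  then have "\<sigma> ** (t ** y') = mat 1" by (simp add: s x'(2))
  \<comment> \<open>Both sides are inverses of \<open>\<sigma>\<close>.\<close>
  then have y': "t ** y' = y"
    using x(2) by (metis matrix_left_right_inverse matrix_mul_assoc matrix_mul_lid matrix_mul_rid)
  have "\<tau> ** q ** y' = (\<tau> ** s) ** p ** (t ** y')"
    by (simp add: s(3) matrix_mul_assoc)
  then have R: "\<tau> ** q ** y' = \<sigma> ** p ** y" by (simp add: y' \<tau>s)
  have "x ** x' = x'" "x' ** x = x"
    using x(3,4) x'(3,4) unfolding R by (metis matrix_mul_assoc)+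
  moreover have "x \<in> idempotents_over d" "x' \<in> idempotents_over d"
    using x(1) x'(1) path_component_mem(2) by blast+
  ultimately have "path_component (idempotents_over d) x x'"
    by (intro path_component_segment) (simp_all add: add.commute)
  then show ?thesis
    using x(1) x'(1) path_component_sym path_component_trans by blast
qed

theorem theorem1p2:
  fixes d :: "complex ^ 'n ^ 'n"
  assumes "d \<in> diagonal_matrices"
  shows "path_connected {q :: complex ^ 'n ^ 'n. idempotent_matrix q \<and> diagonal_expectation q = d}"
  unfolding idempotents_over_def[symmetric] path_connected_component
proof (intro ballI)
  fix p q assume p: "p \<in> idempotents_over d" and q: "q \<in> idempotents_over d"
  have sim: "\<exists>s t. s ** t = mat 1 \<and> t ** s = mat 1 \<and> q = s ** p ** t"
    if "p \<in> idempotents_over d" "q \<in> idempotents_over d" for p q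
  proof -
    have "trace q = trace p"
      using that(2) unfolding idempotents_over_same_fibre[OF that(1)] idempotents_over_iff
      by (simp add: trace_def)
    moreover have "p ** p = p" "q ** q = q"
      using that by (auto simp: idempotents_over_def idempotent_matrix_def)
    ultimately show ?thesis
      by (metis idempotents_same_trace_similar)
  qed
  show "path_component (idempotents_over d) p q"
  proof (cases "p = 0 \<or> p = mat 1 \<or> q = 0 \<or> q = mat 1")
    case True
    \<comment> \<open>All members of the fibre have the same trace, hence are similar, and 0 and 1
      are similar only to themselves.\<close>
    have triv: "y = x" if "x \<in> idempotents_over d" "y \<in> idempotents_over d" "x = 0 \<or> x = mat 1" for x y
      using sim[OF that(1,2)] that(3) by auto
    have "p = q" using True triv[OF p q] triv[OF q p] by blast
    then show ?thesis using p path_component_refl by blast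
  next
    case False
    obtain p' where p': "p' \<in> idempotents_over d" "path_component (idempotents_over d) p p'"
      "inv_sets p' \<subseteq> {{}, UNIV}" using reach_trivial_inv_sets[OF p] False by blast
    obtain q' where q': "q' \<in> idempotents_over d" "path_component (idempotents_over d) q q'"
      "inv_sets q' \<subseteq> {{}, UNIV}" using reach_trivial_inv_sets[OF q] False by blast
    obtain s t where "s ** t = mat 1" "t ** s = mat 1" "q' = s ** p' ** t"
      using sim[OF p'(1) q'(1)] by blast
    then have "path_component (idempotents_over d) p' q'"
      by (rule path_component_trivial_inv_sets[OF p'(1,3) q'(1,3)])
    then show ?thesis
      using p'(2) q'(2) path_component_sym path_component_trans by blast
  qed
qed

end
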